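(* Let $d\ge1$, let $N_1,\ldots,N_d\ge 1$ be integers, let $p_1,\ldots,p_d>0$ with $\sum_{k=1}^d p_k\le 1$, and let $X^*\sim(\nu^*,\mathbf P^* )$ be the generalized coupon collector chain on $\mathbb E^*=\{(i_1,\ldots,i_d):0\le i_j\le N_j,\ 1\le j\le d\}$ with $\nu^*=\delta_{(0,\ldots,0)}$. Assume moreover that $$\sum_{j=1}^d\left(1-\frac{1}{N_j(N_j+1)}\right)p_j\le 1 .$$ Then the chain $X\sim(\nu,\mathbf P)$ on $\mathbb E=\mathbb E^*$ with $\nu=\delta_{(0,\ldots,0)}$ and with transition matrix $$\mathbf P(\mathbf i^{(1)},\mathbf i^{(2)})=\begin{cases} \dfrac{i^{(1)}_k+1}{i^{(1)}_k+2}\,p_k & \text{if } \mathbf i^{(2)}=\mathbf i^{(1)}+\mathbf s_k,\\[2mm] \left(\dfrac{\mathbf 1(i^{(1)}_k<N_k)}{(i^{(1)}_k+1)(i^{(1)}_k+2)}+\dfrac{\mathbf 1(i^{(1)}_k=N_k)}{N_k+1}\right)p_k & \text{if } \mathbf i^{(2)}=\mathbf i^{(1)}-m\,\mathbf s_k \text{ with } 1\le m\le i^{(1)}_k,\\[2mm] 1-\displaystyle\sum_{j:\,i^{(1)}_j<N_j}\left(1-\frac{1}{(i^{(1)}_j+1)(i^{(1)}_j+2)}\right)p_j-\sum_{j:\,i^{(1)}_j=N_j}\frac{N_j}{N_j+1}\,p_j & \text{if } \mathbf i^{(2)}=\mathbf i^{(1)} \end{cases}$$ (all other entries being $0$) is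 an ergodic Markov chain with uniform stationary distribution on $\mathbb E=\mathbb E^*$, and it is a sharp antidual of $X^*$.
   Context: Notation: $\mathbf i=(i_1,\ldots,i_d)$, $\mathbf i^{(r)}=(i^{(r)}_1,\ldots,i^{(r)}_d)$; $\mathbf s_k=(0,\ldots,0,1,0,\ldots,0)$ with $1$ at position $k$, $k\in\{1,\ldots,d\}$. $\delta_{\mathbf i}$ is the point mass at $\mathbf i$. $X\sim(\nu,\mathbf P)$ means initial distribution $\nu$ and transition matrix $\mathbf P$. Ergodic means irreducible and aperiodic. Generalized coupon collector chain: from $\mathbf i\in\mathbb E^*$, $\mathbf P^*(\mathbf i,\mathbf i+\mathbf s_j)=p_j$ if $i_j<N_j$; $\mathbf P^*(\mathbf i,\mathbf i)=1-\sum_{k=1}^d p_k+\sum_{k:\,i_k=N_k}p_k$; all other entries are $0$. Its unique absorbing state is $\mathbf i_{max}=(N_1,\ldots,N_d)$, and $T^*$ is its absorption time there. Sharp antidual: an ergodic chain $X\sim(\nu,\mathbf P)$ with stationary distribution $\pi$ is a sharp antidual of $X^*\sim(\nu^*,\mathbf P^* )$ if there is a stochastic matrix $\Lambda$ with $\Lambda(\mathbf i_{max},\cdot)=\pi$, $\nu=\nu^*\Lambda$ and $\Lambda\mathbf P=\mathbf P^*\Lambda$, and $sep(\nu\mathbf P^k,\pi)=P(T^*>k)$ for all $k\ge0$, where $sep(\nu\mathbf P^k,\pi)=\max_{\mathbf e}(1-\nu\mathbf P^k(\mathbf e)/\pi(\mathbf e))$. *)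

theory Defs
  imports "HOL-Probability.Probability"
begin

section \<open>Finite Markov chains\<close>

text \<open>
  Vectors and matrices indexed by finite state spaces are total real-valued functions; only
  their entries on the state spaces (passed as explicit sets) are meaningful.
\<close>

definition distribution_on :: "'s set \<Rightarrow> ('s \<Rightarrow> real) \<Rightarrow> bool" where
  "distribution_on E \<nu> \<longleftrightarrow> (\<forall>x\<in>E. 0 \<le> \<nu> x) \<and> (\<Sum>x\<in>E. \<nu> x) = 1"

definition stochastic_matrix :: "'s set \<Rightarrow> 't set \<Rightarrow> ('s \<Rightarrow> 't \<Rightarrow> real) \<Rightarrow> bool" where
  "stochastic_matrix A B L \<longleftrightarrow> (\<forall>x\<in>A. distribution_on B (L x))"

definition vec_mat :: "'s set \<Rightarrow> ('s \<Rightarrow> real) \<Rightarrow> ('s \<Rightarrow> 't \<Rightarrow> real) \<Rightarrow> 't \<Rightarrow> real" where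
  "vec_mat E \<nu> P y = (\<Sum>x\<in>E. \<nu> x * P x y)"

definition mat_mat ::
  "'s set \<Rightarrow> ('r \<Rightarrow> 's \<Rightarrow> real) \<Rightarrow> ('s \<Rightarrow> 't \<Rightarrow> real) \<Rightarrow> 'r \<Rightarrow> 't \<Rightarrow> real" where
  "mat_mat E A B x y = (\<Sum>z\<in>E. A x z * B z y)"

fun mat_pow :: "'s set \<Rightarrow> ('s \<Rightarrow> 's \<Rightarrow> real) \<Rightarrow> nat \<Rightarrow> 's \<Rightarrow> 's \<Rightarrow> real" where
  "mat_pow E P 0 = (\<lambda>x y. if x = y then 1 else 0)"
| "mat_pow E P (Suc n) = mat_mat E (mat_pow E P n) P"

definition point_mass :: "'s \<Rightarrow> 's \<Rightarrow> real" where
  "point_mass x = indicator {x}"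

definition irreducible_chain :: "'s set \<Rightarrow> ('s \<Rightarrow> 's \<Rightarrow> real) \<Rightarrow> bool" where
  "irreducible_chain E P \<longleftrightarrow> (\<forall>x\<in>E. \<forall>y\<in>E. \<exists>n. mat_pow E P n x y > 0)"

definition aperiodic_chain :: "'s set \<Rightarrow> ('s \<Rightarrow> 's \<Rightarrow> real) \<Rightarrow> bool" where
  "aperiodic_chain E P \<longleftrightarrow> (\<forall>x\<in>E. Gcd {n. 0 < n \<and> mat_pow E P n x x > 0} = 1)"

definition ergodic_chain :: "'s set \<Rightarrow> ('s \<Rightarrow> 's \<Rightarrow> real) \<Rightarrow> bool" where
  "ergodic_chain E P \<longleftrightarrow> irreducible_chain E P \<and> aperiodic_chain E P"

definition stationary_distribution ::
  "'s set \<Rightarrow> ('s \<Rightarrow> 's \<Rightarrow> real) \<Rightarrow> ('s \<Rightarrow> real) \<Rightarrow> bool" where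
  "stationary_distribution E P \<pi> \<longleftrightarrow> distribution_on E \<pi> \<and> (\<forall>y\<in>E. vec_mat E \<pi> P y = \<pi> y)"

definition separation :: "'s set \<Rightarrow> ('s \<Rightarrow> real) \<Rightarrow> ('s \<Rightarrow> real) \<Rightarrow> real" where
  "separation E \<mu> \<pi> = Max ((\<lambda>x. 1 - \<mu> x / \<pi> x) ` E)"

text \<open>
  \<open>X\<close> is a stochastic process on the probability space \<open>M\<close> with values in the finite set \<open>E\<close>
  that is a (time-homogeneous) Markov chain with initial distribution \<open>\<nu>\<close> and transition
  matrix \<open>P\<close>; the Markov property is expressed by the finite-dimensional distributions.
\<close>

definition markov_chain ::
  "'w measure \<Rightarrow> (nat \<Rightarrow> 'w \<Rightarrow> 's) \<Rightarrow> 's set \<Rightarrow> ('s \<Rightarrow> real) \<Rightarrow> ('s \<Rightarrow> 's \<Rightarrow> real) \<Rightarrow> bool" where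
  "markov_chain M X E \<nu> P \<longleftrightarrow>
     prob_space M \<and> (\<forall>n. X n \<in> measurable M (count_space E)) \<and>
     (\<forall>n e. (\<forall>k\<le>n. e k \<in> E) \<longrightarrow>
        measure M {\<omega> \<in> space M. \<forall>k\<le>n. X k \<omega> = e k} =
          \<nu> (e 0) * (\<Prod>k<n. P (e k) (e (Suc k))))"

text \<open>The value is \<open>\<infinity>\<close> on paths that never visit the absorbing state \<open>a\<close>.\<close>

definition absorption_time :: "(nat \<Rightarrow> 'w \<Rightarrow> 's) \<Rightarrow> 's \<Rightarrow> 'w \<Rightarrow> enat" where
  "absorption_time X a \<omega> = (INF n\<in>{n. X n \<omega> = a}. enat n)"

text \<open>
  The chain with initial distribution \<open>\<nu>\<close> and transition matrix \<open>P\<close> on \<open>E\<close>, with stationary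
  distribution \<open>\<pi>\<close>, is a sharp antidual of the chain \<open>X'\<close> (on the probability space \<open>M\<close>)
  with initial distribution \<open>\<nu>'\<close>, transition matrix \<open>P'\<close> on \<open>E'\<close> and absorbing state \<open>a\<close>.
  The notion depends on the antidual chain only through \<open>\<nu>\<close> and \<open>P\<close>.
\<close>

definition sharp_antidual ::
  "'s set \<Rightarrow> ('s \<Rightarrow> real) \<Rightarrow> ('s \<Rightarrow> 's \<Rightarrow> real) \<Rightarrow> ('s \<Rightarrow> real) \<Rightarrow>
   'w measure \<Rightarrow> (nat \<Rightarrow> 'w \<Rightarrow> 't) \<Rightarrow> 't set \<Rightarrow> ('t \<Rightarrow> real) \<Rightarrow> ('t \<Rightarrow> 't \<Rightarrow> real) \<Rightarrow> 't \<Rightarrow> bool"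
where
  "sharp_antidual E \<nu> P \<pi> M X' E' \<nu>' P' a \<longleftrightarrow>
     distribution_on E \<nu> \<and> stochastic_matrix E E P \<and>
     ergodic_chain E P \<and> stationary_distribution E P \<pi> \<and>
     markov_chain M X' E' \<nu>' P' \<and>
     (\<exists>\<Lambda>. stochastic_matrix E' E \<Lambda> \<and>
          (\<forall>y\<in>E. \<Lambda> a y = \<pi> y) \<and>
          (\<forall>y\<in>E. \<nu> y = vec_mat E' \<nu>' \<Lambda> y) \<and>
          (\<forall>x\<in>E'. \<forall>y\<in>E. mat_mat E \<Lambda> P x y = mat_mat E' P' \<Lambda> x y)) \<and>
     (\<forall>k. separation E (vec_mat E \<nu> (mat_pow E P k)) \<pi> =
          measure M {\<omega> \<in> space M. absorption_time X' a \<omega> > enat k})"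

section \<open>The generalized coupon collector chain and its antidual\<close>

text \<open>
  States are functions on \<open>{1..d}\<close>, made extensional so that each tuple has exactly one
  representative; \<open>i(k := i k + 1)\<close> and \<open>i(k := i k - m)\<close> are \<open>i + s\<^sub>k\<close> and \<open>i - m s\<^sub>k\<close>.
\<close>

definition coupon_space :: "nat \<Rightarrow> (nat \<Rightarrow> nat) \<Rightarrow> (nat \<Rightarrow> nat) set" where
  "coupon_space d N = (\<Pi>\<^sub>E j\<in>{1..d}. {0..N j})"

definition coupon_zero :: "nat \<Rightarrow> nat \<Rightarrow> nat" where
  "coupon_zero d = (\<lambda>j\<in>{1..d}. 0)"

definition coupon_max :: "nat \<Rightarrow> (nat \<Rightarrow> nat) \<Rightarrow> nat \<Rightarrow> nat" where
  "coupon_max d N = (\<lambda>j\<in>{1..d}. N j)"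

text \<open>
  In both matrices below at most one \<open>k\<close> contributes to the sum that gives an off-diagonal
  entry, because a nonzero displacement \<open>i' - i\<close> along a coordinate axis determines \<open>k\<close>;
  if no \<open>k\<close> contributes, the entry is \<open>0\<close>.
\<close>

definition coupon_matrix ::
  "nat \<Rightarrow> (nat \<Rightarrow> nat) \<Rightarrow> (nat \<Rightarrow> real) \<Rightarrow> (nat \<Rightarrow> nat) \<Rightarrow> (nat \<Rightarrow> nat) \<Rightarrow> real" where
  "coupon_matrix d N p i i' =
     (if i' = i then 1 - (\<Sum>k\<in>{1..d}. p k) + (\<Sum>k\<in>{k\<in>{1..d}. i k = N k}. p k)
      else (\<Sum>k\<in>{1..d}. if i k < N k \<and> i' = i(k := i k + 1) then p k else 0))"

definition antidual_matrix ::
  "nat \<Rightarrow> (nat \<Rightarrow> nat) \<Rightarrow> (nat \<Rightarrow> real) \<Rightarrow> (nat \<Rightarrow> nat) \<Rightarrow> (nat \<Rightarrow> nat) \<Rightarrow> real" where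
  "antidual_matrix d N p i i' =
     (if i' = i then
        1 - (\<Sum>j\<in>{j\<in>{1..d}. i j < N j}. (1 - 1 / ((real (i j) + 1) * (real (i j) + 2))) * p j)
          - (\<Sum>j\<in>{j\<in>{1..d}. i j = N j}. real (N j) / (real (N j) + 1) * p j)
      else
        (\<Sum>k\<in>{1..d}.
           if i' = i(k := i k + 1) then (real (i k) + 1) / (real (i k) + 2) * p k
           else if \<exists>m\<in>{1..i k}. i' = i(k := i k - m) then
             (of_bool (i k < N k) / ((real (i k) + 1) * (real (i k) + 2))
               + of_bool (i k = N k) / (real (N k) + 1)) * p k
           else 0))"

end

theory Submission
  imports Defs
begin

text \<open>
  Both chains move one coordinate at a time: coordinate \<open>k\<close> is selected with probability \<open>p k\<close>, and
  with the remaining probability nothing happens. Once the state after a selection is prescribed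
  by a kernel on \<open>{0..N k}\<close>, the whole matrix is determined (\<open>axis_mixture\<close>). For the coupon collector
  this kernel is the deterministic \<open>climb\<close>, which adds one until the level \<open>N k\<close> is reached. For
  the other chain it is \<open>climb_or_reset\<close>. The seemingly irregular diagonal of the antidual matrix is
  what remains when every selected coordinate \<open>a\<close> may also stay at \<open>a\<close>, with the same probability
  as each of the downward jumps.

  In one coordinate, \<open>climb_or_reset\<close> carries the uniform distribution on \<open>{0..a}\<close> to the uniform
  distribution on \<open>{0..a + 1}\<close>, or fixes it if \<open>a\<close> is already the top level. Thus the kernel
  \<open>uniform_below\<close> intertwines it with \<open>climb\<close> (\<open>uniform_below_intertwining\<close>). Selecting a coordinate
  leaves the others alone, so the product of these kernels intertwines the two mixtures
  (\<open>axis_mixture_intertwining\<close>). This product \<open>\<Lambda>\<close> is the link: \<open>\<Lambda> x\<close> is uniform on the box below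
  \<open>x\<close>. Its row at the absorbing state is the uniform distribution on the whole space, which is
  therefore stationary; its row at zero is a point mass, so both chains start at zero.

  By the intertwining, the law of the antidual at time \<open>k\<close> is \<open>\<mu>\<^sub>k \<Lambda>\<close>, where \<open>\<mu>\<^sub>k\<close> is the law of
  the coupon collector. Keeping only the mass that \<open>\<mu>\<^sub>k\<close> gives to the absorbing state bounds
  \<open>\<mu>\<^sub>k \<Lambda>\<close> from below by that mass times the uniform distribution. The bound is attained at the
  maximal state, because no smaller box contains it. Hence the separation is the probability that
  the collector is not yet absorbed (\<open>separation_of_sharp_link\<close>, \<open>absorption_time_tail\<close>).

  Ergodicity needs no duality: the antidual can step down and back up in each coordinate, hence
  it connects every state with zero, and its diagonal is positive.
\<close>

section \<open>Powers of a transition matrix and links\<close>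

lemma vec_mat_pow_Suc:
  "vec_mat E \<nu> (mat_pow E P (Suc n)) y = vec_mat E (vec_mat E \<nu> (mat_pow E P n)) P y"
proof -
  have "vec_mat E \<nu> (mat_pow E P (Suc n)) y = (\<Sum>x\<in>E. \<Sum>z\<in>E. \<nu> x * mat_pow E P n x z * P z y)"
    by (simp add: vec_mat_def mat_mat_def sum_distrib_left mult.assoc)
  also have "\<dots> = (\<Sum>z\<in>E. \<Sum>x\<in>E. \<nu> x * mat_pow E P n x z * P z y)"
    by (rule sum.swap)
  finally show ?thesis
    by (simp add: vec_mat_def sum_distrib_right)
qed

lemma vec_mat_pow_0:
  assumes "finite E" "y \<in> E"
  shows "vec_mat E \<nu> (mat_pow E P 0) y = \<nu> y"
  using assms by (simp add: vec_mat_def if_distrib[of "\<lambda>t. _ * t"] cong: if_cong)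

lemma distribution_vec_mat:
  assumes "distribution_on A \<mu>" "stochastic_matrix A B L"
  shows "distribution_on B (vec_mat A \<mu> L)"
proof -
  have "(\<Sum>y\<in>B. vec_mat A \<mu> L y) = (\<Sum>x\<in>A. \<Sum>y\<in>B. \<mu> x * L x y)"
    unfolding vec_mat_def by (rule sum.swap)
  also have "\<dots> = (\<Sum>x\<in>A. \<mu> x * (\<Sum>y\<in>B. L x y))"
    by (simp add: sum_distrib_left)
  also have "\<dots> = 1"
    using assms by (simp add: distribution_on_def stochastic_matrix_def)
  finally show ?thesis
    using assms by (auto simp: distribution_on_def stochastic_matrix_def vec_mat_def intro!: sum_nonneg)
qed

lemma distribution_vec_mat_pow:
  assumes "finite E" "distribution_on E \<nu>" "stochastic_matrix E E P"
  shows "distribution_on E (vec_mat E \<nu> (mat_pow E P n))"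
proof (induction n)
  case 0
  then show ?case
    using assms(1,2) by (simp add: distribution_on_def vec_mat_pow_0 del: mat_pow.simps)
next
  case (Suc n)
  have "distribution_on E (vec_mat E (vec_mat E \<nu> (mat_pow E P n)) P)"
    by (rule distribution_vec_mat[OF Suc assms(3)])
  then show ?case
    by (simp only: vec_mat_pow_Suc[abs_def])
qed

text \<open>
  The relation \<open>\<Lambda> P = P' \<Lambda>\<close> lets \<open>\<Lambda>\<close> pass through each step in turn, so a law of the second chain
  followed by \<open>\<Lambda>\<close> remains a law of the first.
\<close>

lemma link_transports_law:
  assumes fin: "finite E" "finite E'"
    and init: "\<And>y. y \<in> E \<Longrightarrow> \<nu> y = vec_mat E' \<nu>' \<Lambda> y"
    and link: "\<And>x y. x \<in> E' \<Longrightarrow> y \<in> E \<Longrightarrow> mat_mat E \<Lambda> P x y = mat_mat E' P' \<Lambda> x y"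
    and y: "y \<in> E"
  shows "vec_mat E \<nu> (mat_pow E P n) y = vec_mat E' (vec_mat E' \<nu>' (mat_pow E' P' n)) \<Lambda> y"
  using y
proof (induction n arbitrary: y)
  case 0
  have "vec_mat E' (vec_mat E' \<nu>' (mat_pow E' P' 0)) \<Lambda> y = vec_mat E' \<nu>' \<Lambda> y"
    unfolding vec_mat_def[of E' _ \<Lambda>]
    by (rule sum.cong) (simp_all add: vec_mat_pow_0 fin del: mat_pow.simps)
  then show ?case
    using 0 init fin by (simp add: vec_mat_pow_0 del: mat_pow.simps)
next
  case (Suc n)
  define \<mu> where "\<mu> = vec_mat E' \<nu>' (mat_pow E' P' n)"
  have "vec_mat E \<nu> (mat_pow E P (Suc n)) y = (\<Sum>z\<in>E. vec_mat E' \<mu> \<Lambda> z * P z y)"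
    unfolding vec_mat_pow_Suc vec_mat_def[of E _ P] \<mu>_def
    by (rule sum.cong) (simp_all add: Suc.IH)
  also have "\<dots> = (\<Sum>z\<in>E. \<Sum>x\<in>E'. \<mu> x * (\<Lambda> x z * P z y))"
    by (simp add: vec_mat_def sum_distrib_right mult.assoc)
  also have "\<dots> = (\<Sum>x\<in>E'. \<mu> x * mat_mat E \<Lambda> P x y)"
    by (subst sum.swap) (simp add: mat_mat_def sum_distrib_left)
  also have "\<dots> = (\<Sum>x\<in>E'. \<mu> x * mat_mat E' P' \<Lambda> x y)"
    using link Suc.prems by simp
  also have "\<dots> = (\<Sum>x\<in>E'. \<Sum>z\<in>E'. \<mu> x * P' x z * \<Lambda> z y)"
    by (simp add: mat_mat_def sum_distrib_left mult.assoc)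
  also have "\<dots> = (\<Sum>z\<in>E'. vec_mat E' \<mu> P' z * \<Lambda> z y)"
    by (subst sum.swap) (simp add: vec_mat_def sum_distrib_right)
  finally show ?case
    by (simp only: vec_mat_pow_Suc[abs_def] vec_mat_def[of E' _ \<Lambda>] \<mu>_def)
qed

text \<open>
  The mixture \<open>\<mu> \<Lambda>\<close> contains the component \<open>\<mu> a \<cdot> \<pi>\<close>, so \<open>1 - \<mu> a\<close> bounds the separation from above.
  The state \<open>b\<close>, which is out of reach of every other row of \<open>\<Lambda>\<close>, receives nothing beyond
  this component and attains the bound.
\<close>

lemma separation_of_sharp_link:
  assumes fin: "finite E" "finite E'"
    and \<mu>: "distribution_on E' \<mu>" and \<Lambda>: "stochastic_matrix E' E \<Lambda>"
    and a: "a \<in> E'" and \<Lambda>_a: "\<And>y. y \<in> E \<Longrightarrow> \<Lambda> a y = \<pi> y"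
    and \<pi>: "\<And>y. y \<in> E \<Longrightarrow> \<pi> y > 0"
    and b: "b \<in> E" and only_a: "\<And>x. x \<in> E' \<Longrightarrow> x \<noteq> a \<Longrightarrow> \<Lambda> x b = 0"
  shows "separation E (vec_mat E' \<mu> \<Lambda>) \<pi> = 1 - \<mu> a"
proof -
  have split: "vec_mat E' \<mu> \<Lambda> y = \<mu> a * \<pi> y + (\<Sum>x\<in>E' - {a}. \<mu> x * \<Lambda> x y)" if "y \<in> E" for y
    using sum.remove[OF fin(2) a, of "\<lambda>x. \<mu> x * \<Lambda> x y"] \<Lambda>_a[OF that] by (simp add: vec_mat_def)
  have "1 - vec_mat E' \<mu> \<Lambda> y / \<pi> y \<le> 1 - \<mu> a" if y: "y \<in> E" for y
  proof -
    have "(\<Sum>x\<in>E' - {a}. \<mu> x * \<Lambda> x y) \<ge> 0"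
      using \<mu> \<Lambda> y by (auto simp: distribution_on_def stochastic_matrix_def intro!: sum_nonneg)
    then show ?thesis
      using split[OF y] \<pi>[OF y] by (simp add: pos_le_divide_eq)
  qed
  moreover have "1 - vec_mat E' \<mu> \<Lambda> b / \<pi> b = 1 - \<mu> a"
    using split[OF b] \<pi>[OF b] only_a by simp
  ultimately show ?thesis
    unfolding separation_def using fin b by (intro Max_eqI) (auto intro: rev_image_eqI)
qed

section \<open>Absorption times\<close>

lemma absorption_time_greater_iff:
  "enat k < absorption_time X a \<omega> \<longleftrightarrow> (\<forall>n\<le>k. X n \<omega> \<noteq> a)"
proof
  assume less: "enat k < absorption_time X a \<omega>"
  show "\<forall>n\<le>k. X n \<omega> \<noteq> a"
  proof (intro allI impI notI)
    fix n assume n: "n \<le> k" "X n \<omega> = a"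
    then have "absorption_time X a \<omega> \<le> enat n"
      unfolding absorption_time_def by (intro INF_lower) simp
    also have "\<dots> \<le> enat k"
      using n by simp
    finally show False
      using less by simp
  qed
next
  assume "\<forall>n\<le>k. X n \<omega> \<noteq> a"
  then have "enat (Suc k) \<le> absorption_time X a \<omega>"
    unfolding absorption_time_def by (intro INF_greatest) (auto simp: not_less_eq_eq[symmetric])
  then show "enat k < absorption_time X a \<omega>"
    by (rule less_le_trans[rotated]) simp
qed

lemma markov_chain_state_in:
  assumes "markov_chain M X E \<nu> P" "\<omega> \<in> space M"
  shows "X n \<omega> \<in> E"
  using assms measurable_space[of "X n" M "count_space E" \<omega>]
  by (auto simp: markov_chain_def)

text \<open>
  The Markov property is given for whole trajectories only. Splitting according to the trajectory
  up to time \<open>n\<close> gives the one-step form, since the last factor of each product is \<open>P x y\<close>.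
\<close>

lemma markov_chain_step:
  assumes mc: "markov_chain M X E \<nu> P" and fin: "finite E" and x: "x \<in> E" and y: "y \<in> E"
  shows "measure M {\<omega> \<in> space M. X n \<omega> = x \<and> X (Suc n) \<omega> = y}
    = measure M {\<omega> \<in> space M. X n \<omega> = x} * P x y"
proof -
  interpret prob_space M
    using mc by (simp add: markov_chain_def)
  have [measurable]: "X k \<in> measurable M (count_space E)" for k
    using mc by (simp add: markov_chain_def)
  define paths where "paths = {e \<in> {..n} \<rightarrow>\<^sub>E E. e n = x}"
  have fin_paths: "finite paths"
    unfolding paths_def using fin by (simp add: finite_PiE)
  \<comment> \<open>The extra event \<open>Q\<close> allows the same splitting for the trivial event and for the next step.\<close>
  have by_paths: "measure M {\<omega> \<in> space M. X n \<omega> = x \<and> Q \<omega>}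
      = (\<Sum>e\<in>paths. measure M {\<omega> \<in> space M. (\<forall>k\<le>n. X k \<omega> = e k) \<and> Q \<omega>})"
    if [measurable]: "Measurable.pred M Q" for Q
  proof -
    have "{\<omega> \<in> space M. X n \<omega> = x \<and> Q \<omega>}
        = (\<Union>e\<in>paths. {\<omega> \<in> space M. (\<forall>k\<le>n. X k \<omega> = e k) \<and> Q \<omega>})"
    proof (intro set_eqI iffI)
      fix \<omega> assume \<omega>: "\<omega> \<in> {\<omega> \<in> space M. X n \<omega> = x \<and> Q \<omega>}"
      then have "restrict (\<lambda>k. X k \<omega>) {..n} \<in> paths"
        using markov_chain_state_in[OF mc] by (auto simp: paths_def)
      then show "\<omega> \<in> (\<Union>e\<in>paths. {\<omega> \<in> space M. (\<forall>k\<le>n. X k \<omega> = e k) \<and> Q \<omega>})"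
        using \<omega> by (intro UN_I) auto
    qed (auto simp: paths_def)
    moreover have "disjoint_family_on (\<lambda>e. {\<omega> \<in> space M. (\<forall>k\<le>n. X k \<omega> = e k) \<and> Q \<omega>}) paths"
    proof (unfold disjoint_family_on_def, intro ballI impI)
      fix e e' assume e: "e \<in> paths" "e' \<in> paths" "e \<noteq> e'"
      then obtain k where "k \<le> n" "e k \<noteq> e' k"
        unfolding paths_def by (metis (no_types, lifting) PiE_ext atMost_iff mem_Collect_eq)
      then show "{\<omega> \<in> space M. (\<forall>k\<le>n. X k \<omega> = e k) \<and> Q \<omega>} \<inter>
          {\<omega> \<in> space M. (\<forall>k\<le>n. X k \<omega> = e' k) \<and> Q \<omega>} = {}"
        by auto
    qed
    ultimately show ?thesis
      using fin_paths by (auto intro!: finite_measure_finite_Union)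
  qed
  have fdd: "measure M {\<omega> \<in> space M. \<forall>k\<le>m. X k \<omega> = e k} = \<nu> (e 0) * (\<Prod>k<m. P (e k) (e (Suc k)))"
    if "\<forall>k\<le>m. e k \<in> E" for m e
    using mc that by (auto simp: markov_chain_def)
  have extend: "measure M {\<omega> \<in> space M. (\<forall>k\<le>n. X k \<omega> = e k) \<and> X (Suc n) \<omega> = y}
      = measure M {\<omega> \<in> space M. \<forall>k\<le>n. X k \<omega> = e k} * P x y" if e: "e \<in> paths" for e
  proof -
    have eE: "\<forall>k\<le>n. e k \<in> E" and en: "e n = x"
      using e by (auto simp: paths_def)
    let ?e = "e(Suc n := y)"
    have "{\<omega> \<in> space M. (\<forall>k\<le>n. X k \<omega> = e k) \<and> X (Suc n) \<omega> = y}
        = {\<omega> \<in> space M. \<forall>k\<le>Suc n. X k \<omega> = ?e k}"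
      by (auto simp: le_Suc_eq)
    moreover have "\<forall>k\<le>Suc n. ?e k \<in> E"
      using eE y by auto
    ultimately show ?thesis
      using fdd[OF eE] fdd[of "Suc n" ?e] en by (simp add: lessThan_Suc)
  qed
  have "Measurable.pred M (\<lambda>\<omega>. X (Suc n) \<omega> = y)"
    by measurable
  from by_paths[OF this] show ?thesis
    using by_paths[of "\<lambda>_. True"] by (simp add: extend sum_distrib_right)
qed

lemma markov_chain_marginal:
  assumes mc: "markov_chain M X E \<nu> P" and fin: "finite E" and y: "y \<in> E"
  shows "measure M {\<omega> \<in> space M. X n \<omega> = y} = vec_mat E \<nu> (mat_pow E P n) y"
  using y
proof (induction n arbitrary: y)
  case 0
  have "measure M {\<omega> \<in> space M. \<forall>k\<le>0. X k \<omega> = (\<lambda>_. y) k} = \<nu> y * (\<Prod>k<(0::nat). P y y)"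
    using mc 0 unfolding markov_chain_def by (auto dest!: spec[of _ "0::nat"])
  then show ?case
    using 0 fin by (simp add: vec_mat_pow_0 del: mat_pow.simps)
next
  case (Suc n)
  interpret prob_space M
    using mc by (simp add: markov_chain_def)
  have [measurable]: "X k \<in> measurable M (count_space E)" for k
    using mc by (simp add: markov_chain_def)
  have "{\<omega> \<in> space M. X (Suc n) \<omega> = y} = (\<Union>x\<in>E. {\<omega> \<in> space M. X n \<omega> = x \<and> X (Suc n) \<omega> = y})"
    using markov_chain_state_in[OF mc] by auto
  then have "measure M {\<omega> \<in> space M. X (Suc n) \<omega> = y}
      = (\<Sum>x\<in>E. measure M {\<omega> \<in> space M. X n \<omega> = x \<and> X (Suc n) \<omega> = y})"
    using fin by (auto intro!: finite_measure_finite_Union simp: disjoint_family_on_def)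
  also have "\<dots> = (\<Sum>x\<in>E. vec_mat E \<nu> (mat_pow E P n) x * P x y)"
    using markov_chain_step[OF mc fin _ Suc.prems] Suc.IH by simp
  finally show ?case
    by (simp only: vec_mat_pow_Suc vec_mat_def[of E _ P])
qed

text \<open>
  Absorption by time \<open>k\<close> means a visit to \<open>a\<close> at some time up to \<open>k\<close>. Almost surely such a visit
  persists, because each step from \<open>a\<close> to another state is a null event, so the marginal law at
  time \<open>k\<close> alone determines the probability.
\<close>

lemma absorption_time_tail:
  assumes mc: "markov_chain M X E \<nu> P" and fin: "finite E" and a: "a \<in> E"
    and absorbing: "\<And>y. y \<in> E \<Longrightarrow> y \<noteq> a \<Longrightarrow> P a y = 0"
  shows "measure M {\<omega> \<in> space M. enat k < absorption_time X a \<omega>}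
    = 1 - vec_mat E \<nu> (mat_pow E P k) a"
proof -
  interpret prob_space M
    using mc by (simp add: markov_chain_def)
  have [measurable]: "X k \<in> measurable M (count_space E)" for k
    using mc by (simp add: markov_chain_def)
  have "AE \<omega> in M. \<forall>y\<in>E - {a}. \<not> (X n \<omega> = a \<and> X (Suc n) \<omega> = y)" for n
  proof (subst AE_finite_all)
    show "\<forall>y\<in>E - {a}. AE \<omega> in M. \<not> (X n \<omega> = a \<and> X (Suc n) \<omega> = y)"
    proof
      fix y assume "y \<in> E - {a}"
      then have "prob {\<omega> \<in> space M. X n \<omega> = a \<and> X (Suc n) \<omega> = y} = 0"
        using markov_chain_step[OF mc fin a, of y] absorbing by simp
      then show "AE \<omega> in M. \<not> (X n \<omega> = a \<and> X (Suc n) \<omega> = y)"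
        by (subst (asm) prob_eq_0) auto
    qed
  qed (use fin in simp)
  then have "AE \<omega> in M. \<forall>n. \<forall>y\<in>E - {a}. \<not> (X n \<omega> = a \<and> X (Suc n) \<omega> = y)"
    by (simp add: AE_all_countable)
  then have "AE \<omega> in M. (\<exists>n\<le>k. X n \<omega> = a) \<longrightarrow> X k \<omega> = a"
    using AE_space
  proof eventually_elim
    case (elim \<omega>)
    then have stay: "X n \<omega> = a \<Longrightarrow> X (Suc n) \<omega> = a" for n
      using markov_chain_state_in[OF mc] by blast
    have "X k \<omega> = a" if "n \<le> k" "X n \<omega> = a" for n
      using that by (induction k rule: dec_induct) (simp_all only: stay)
    then show ?case
      by blast
  qed
  then have "prob {\<omega> \<in> space M. \<forall>n\<le>k. X n \<omega> \<noteq> a} = prob {\<omega> \<in> space M. \<not> X k \<omega> = a}"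
    by (intro measure_eq_AE) auto
  also have "\<dots> = 1 - prob {\<omega> \<in> space M. X k \<omega> = a}"
    by (rule prob_neg) measurable
  finally show ?thesis
    by (simp add: absorption_time_greater_iff markov_chain_marginal[OF mc fin a])
qed

section \<open>Irreducibility from positive steps\<close>

lemma mat_pow_nonneg:
  assumes "\<And>x y. x \<in> E \<Longrightarrow> y \<in> E \<Longrightarrow> P x y \<ge> 0" "x \<in> E" "y \<in> E"
  shows "mat_pow E P n x y \<ge> 0"
  using assms(3)
  by (induction n arbitrary: y) (auto simp: mat_mat_def assms(1,2) intro!: sum_nonneg)

lemma mat_pow_pos_of_steps:
  assumes fin: "finite E" and nonneg: "\<And>x y. x \<in> E \<Longrightarrow> y \<in> E \<Longrightarrow> P x y \<ge> 0"
    and x: "x \<in> E" and steps: "(x, y) \<in> {(u, v). u \<in> E \<and> v \<in> E \<and> P u v > 0}\<^sup>*"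
  shows "\<exists>n. mat_pow E P n x y > 0"
  using steps
proof induction
  case base
  have "mat_pow E P 0 x x > 0"
    by simp
  then show ?case ..
next
  case (step u v)
  then obtain n where n: "mat_pow E P n x u > 0"
    by blast
  have uv: "u \<in> E" "v \<in> E" "P u v > 0"
    using step.hyps by auto
  have "mat_pow E P (Suc n) x v > 0"
    unfolding mat_pow.simps mat_mat_def
    using fin uv n mat_pow_nonneg[OF nonneg x] nonneg
    by (intro sum_pos2[of E u]) auto
  then show ?case ..
qed

section \<open>Mixtures of one-coordinate moves\<close>

text \<open>
  The condition \<open>x(k := y k) = y\<close> says that \<open>x\<close> and \<open>y\<close> differ at most in coordinate \<open>k\<close>. It also
  holds for \<open>x = y\<close>, and therefore all coordinates contribute to the diagonal.
\<close>

definition axis_mixture ::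
  "nat \<Rightarrow> (nat \<Rightarrow> real) \<Rightarrow> (nat \<Rightarrow> nat \<Rightarrow> nat \<Rightarrow> real) \<Rightarrow> (nat \<Rightarrow> nat) \<Rightarrow> (nat \<Rightarrow> nat) \<Rightarrow> real" where
  "axis_mixture d p Q x y = (1 - (\<Sum>k\<in>{1..d}. p k)) * of_bool (x = y)
     + (\<Sum>k\<in>{1..d}. p k * (of_bool (x(k := y k) = y) * Q k (x k) (y k)))"

definition product_kernel ::
  "nat \<Rightarrow> (nat \<Rightarrow> nat \<Rightarrow> real) \<Rightarrow> (nat \<Rightarrow> nat) \<Rightarrow> (nat \<Rightarrow> nat) \<Rightarrow> real" where
  "product_kernel d L x y = (\<Prod>j\<in>{1..d}. L (x j) (y j))"

lemma finite_coupon_space [simp]: "finite (coupon_space d N)"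
  by (simp add: coupon_space_def finite_PiE)

lemma coupon_space_le: "x \<in> coupon_space d N \<Longrightarrow> k \<in> {1..d} \<Longrightarrow> x k \<le> N k"
  by (auto simp: coupon_space_def PiE_iff)

lemma coupon_space_update:
  "x \<in> coupon_space d N \<Longrightarrow> k \<in> {1..d} \<Longrightarrow> a \<le> N k \<Longrightarrow> x(k := a) \<in> coupon_space d N"
  by (auto simp: coupon_space_def PiE_iff extensional_def)

lemma coupon_space_eqI:
  "x \<in> coupon_space d N \<Longrightarrow> y \<in> coupon_space d N \<Longrightarrow> (\<And>j. j \<in> {1..d} \<Longrightarrow> x j = y j) \<Longrightarrow> x = y"
  unfolding coupon_space_def by (rule PiE_ext)

lemma sum_along_axis:
  assumes x: "x \<in> coupon_space d N" and k: "k \<in> {1..d}"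
  shows "(\<Sum>y\<in>coupon_space d N. of_bool (x(k := y k) = y) * f y) = (\<Sum>a\<in>{0..N k}. f (x(k := a)) :: real)"
proof -
  have "(\<Sum>y\<in>coupon_space d N. of_bool (x(k := y k) = y) * f y)
      = (\<Sum>y\<in>{y \<in> coupon_space d N. x(k := y k) = y}. f y)"
    unfolding sum.inter_filter[OF finite_coupon_space] by (rule sum.cong) simp_all
  also have "{y \<in> coupon_space d N. x(k := y k) = y} = (\<lambda>a. x(k := a)) ` {0..N k}"
  proof (intro set_eqI iffI)
    fix y assume "y \<in> {y \<in> coupon_space d N. x(k := y k) = y}"
    then show "y \<in> (\<lambda>a. x(k := a)) ` {0..N k}"
      using coupon_space_le[of y d N k] k by (intro image_eqI[of _ _ "y k"]) auto
  qed (auto simp: coupon_space_update[OF x k])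
  also have "(\<Sum>y\<in>\<dots>. f y) = (\<Sum>a\<in>{0..N k}. f (x(k := a)))"
    by (subst sum.reindex) (auto intro!: inj_onI dest: fun_upd_eqD)
  finally show ?thesis .
qed

lemma product_kernel_update_right:
  "k \<in> {1..d} \<Longrightarrow> product_kernel d L x (y(k := a)) = L (x k) a * (\<Prod>j\<in>{1..d} - {k}. L (x j) (y j))"
  unfolding product_kernel_def by (subst prod.remove[of _ k]) auto

lemma product_kernel_update_left:
  "k \<in> {1..d} \<Longrightarrow> product_kernel d L (x(k := a)) y = L a (y k) * (\<Prod>j\<in>{1..d} - {k}. L (x j) (y j))"
  unfolding product_kernel_def by (subst prod.remove[of _ k]) auto

lemma axis_mixture_stochastic:
  assumes p: "\<And>k. k \<in> {1..d} \<Longrightarrow> p k \<ge> 0" "(\<Sum>k\<in>{1..d}. p k) \<le> 1"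
    and Q: "\<And>k. k \<in> {1..d} \<Longrightarrow> stochastic_matrix {0..N k} {0..N k} (Q k)"
  shows "stochastic_matrix (coupon_space d N) (coupon_space d N) (axis_mixture d p Q)"
proof -
  have "distribution_on (coupon_space d N) (axis_mixture d p Q x)" if x: "x \<in> coupon_space d N" for x
  proof -
    have "axis_mixture d p Q x y \<ge> 0" if "y \<in> coupon_space d N" for y
      using p Q coupon_space_le[OF x] coupon_space_le[OF that]
      by (auto simp: axis_mixture_def stochastic_matrix_def distribution_on_def
          intro!: add_nonneg_nonneg sum_nonneg mult_nonneg_nonneg)
    moreover have "(\<Sum>y\<in>coupon_space d N. axis_mixture d p Q x y)
        = (1 - sum p {1..d}) * (\<Sum>y\<in>coupon_space d N. of_bool (x = y))
          + (\<Sum>k\<in>{1..d}. p k * (\<Sum>y\<in>coupon_space d N. of_bool (x(k := y k) = y) * Q k (x k) (y k)))"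
      unfolding axis_mixture_def sum.distrib sum_distrib_left by (subst sum.swap) simp
    moreover have "(\<Sum>y\<in>coupon_space d N. of_bool (x(k := y k) = y) * Q k (x k) (y k)) = 1"
      if k: "k \<in> {1..d}" for k
      using sum_along_axis[OF x k, of "\<lambda>y. Q k (x k) (y k)"] Q[OF k] coupon_space_le[OF x k]
      by (simp add: stochastic_matrix_def distribution_on_def)
    moreover have "(\<Sum>y\<in>coupon_space d N. of_bool (x = y)) = (1::real)"
      using x by (simp add: of_bool_def)
    ultimately show ?thesis
      by (simp add: distribution_on_def)
  qed
  then show ?thesis
    by (simp add: stochastic_matrix_def)
qed

lemma product_kernel_stochastic:
  assumes L: "\<And>k a. k \<in> {1..d} \<Longrightarrow> a \<le> N k \<Longrightarrow> distribution_on {0..N k} (L a)"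
  shows "stochastic_matrix (coupon_space d N) (coupon_space d N) (product_kernel d L)"
  unfolding stochastic_matrix_def
proof
  fix x assume x: "x \<in> coupon_space d N"
  have dist: "distribution_on {0..N k} (L (x k))" if "k \<in> {1..d}" for k
    using L coupon_space_le[OF x that] that by blast
  have "(\<Sum>y\<in>coupon_space d N. product_kernel d L x y) = (\<Prod>j\<in>{1..d}. \<Sum>b\<in>{0..N j}. L (x j) b)"
    unfolding coupon_space_def product_kernel_def by (subst prod_sum_PiE) auto
  also have "\<dots> = 1"
    using dist by (simp add: distribution_on_def)
  finally show "distribution_on (coupon_space d N) (product_kernel d L x)"
    using dist coupon_space_le
    by (fastforce simp: distribution_on_def product_kernel_def intro!: prod_nonneg)
qed

text \<open>
  A move in coordinate \<open>k\<close>, before or after the product kernel, changes only the factor of that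
  kernel at \<open>k\<close>. Both composites equal the one-coordinate composite times the common product \<open>R k\<close>
  over the other coordinates.
\<close>

lemma axis_mixture_intertwining:
  assumes coord: "\<And>k a b. k \<in> {1..d} \<Longrightarrow> a \<le> N k \<Longrightarrow> b \<le> N k \<Longrightarrow>
      mat_mat {0..N k} L (Q k) a b = mat_mat {0..N k} (C k) L a b"
    and x: "x \<in> coupon_space d N" and y: "y \<in> coupon_space d N"
  shows "mat_mat (coupon_space d N) (product_kernel d L) (axis_mixture d p Q) x y
    = mat_mat (coupon_space d N) (axis_mixture d p C) (product_kernel d L) x y"
proof -
  let ?E = "coupon_space d N" and ?\<Lambda> = "product_kernel d L"
  define R where "R k = (\<Prod>j\<in>{1..d} - {k}. L (x j) (y j))" for k
  \<comment> \<open>Turns a sum over the sources of moves into \<open>y\<close> into a sum along the axis through \<open>y\<close>.\<close>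
  have sym: "(z(k := y k) = y) = (y(k := z k) = z)" for z :: "nat \<Rightarrow> nat" and k
    by (metis fun_upd_triv fun_upd_upd)
  have left: "(\<Sum>z\<in>?E. ?\<Lambda> x z * (of_bool (z(k := y k) = y) * Q k (z k) (y k)))
      = mat_mat {0..N k} L (Q k) (x k) (y k) * R k" if k: "k \<in> {1..d}" for k
  proof -
    have "(\<Sum>z\<in>?E. ?\<Lambda> x z * (of_bool (z(k := y k) = y) * Q k (z k) (y k)))
        = (\<Sum>z\<in>?E. of_bool (y(k := z k) = z) * (?\<Lambda> x z * Q k (z k) (y k)))"
      by (simp add: sym mult_ac)
    also have "\<dots> = (\<Sum>a\<in>{0..N k}. ?\<Lambda> x (y(k := a)) * Q k a (y k))"
      by (subst sum_along_axis[OF y k]) simp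
    finally show ?thesis
      by (simp add: product_kernel_update_right[OF k] mat_mat_def R_def sum_distrib_left sum_distrib_right mult_ac)
  qed
  have right: "(\<Sum>z\<in>?E. of_bool (x(k := z k) = z) * C k (x k) (z k) * ?\<Lambda> z y)
      = mat_mat {0..N k} (C k) L (x k) (y k) * R k" if k: "k \<in> {1..d}" for k
  proof -
    have "(\<Sum>z\<in>?E. of_bool (x(k := z k) = z) * C k (x k) (z k) * ?\<Lambda> z y)
        = (\<Sum>a\<in>{0..N k}. C k (x k) a * ?\<Lambda> (x(k := a)) y)"
      using sum_along_axis[OF x k, of "\<lambda>z. C k (x k) (z k) * ?\<Lambda> z y"] by (simp add: mult_ac)
    then show ?thesis
      by (simp add: product_kernel_update_left[OF k] mat_mat_def R_def sum_distrib_left sum_distrib_right mult_ac)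
  qed
  have "mat_mat ?E ?\<Lambda> (axis_mixture d p Q) x y
      = (1 - sum p {1..d}) * (\<Sum>z\<in>?E. ?\<Lambda> x z * of_bool (z = y))
        + (\<Sum>k\<in>{1..d}. p k * (\<Sum>z\<in>?E. ?\<Lambda> x z * (of_bool (z(k := y k) = y) * Q k (z k) (y k))))"
    unfolding mat_mat_def axis_mixture_def distrib_left sum.distrib sum_distrib_left
      sum.swap[where A = ?E and B = "{1..d}"]
    by (simp add: mult_ac)
  also have "\<dots> = (1 - sum p {1..d}) * ?\<Lambda> x y
        + (\<Sum>k\<in>{1..d}. p k * (mat_mat {0..N k} L (Q k) (x k) (y k) * R k))"
    using left y by (simp add: of_bool_def if_distrib[of "\<lambda>t. _ * t"] cong: if_cong)
  also have "\<dots> = (1 - sum p {1..d}) * ?\<Lambda> x y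
        + (\<Sum>k\<in>{1..d}. p k * (mat_mat {0..N k} (C k) L (x k) (y k) * R k))"
    using coord coupon_space_le[OF x] coupon_space_le[OF y] by simp
  also have "\<dots> = (1 - sum p {1..d}) * (\<Sum>z\<in>?E. of_bool (x = z) * ?\<Lambda> z y)
        + (\<Sum>k\<in>{1..d}. p k * (\<Sum>z\<in>?E. of_bool (x(k := z k) = z) * C k (x k) (z k) * ?\<Lambda> z y))"
    using right x by (simp add: of_bool_def if_distrib[of "\<lambda>t. t * _"] cong: if_cong)
  also have "\<dots> = mat_mat ?E (axis_mixture d p C) ?\<Lambda> x y"
    unfolding mat_mat_def axis_mixture_def distrib_right sum.distrib sum_distrib_left sum_distrib_right
      sum.swap[where A = ?E and B = "{1..d}"]
    by (simp add: mult_ac)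
  finally show ?thesis .
qed

section \<open>The one-coordinate kernels\<close>

definition climb :: "nat \<Rightarrow> nat \<Rightarrow> nat \<Rightarrow> real" where
  "climb n a b = of_bool (b = min (Suc a) n)"

definition uniform_below :: "nat \<Rightarrow> nat \<Rightarrow> real" where
  "uniform_below a b = of_bool (b \<le> a) / (real a + 1)"

text \<open>
  Below the top, a step from \<open>a\<close> climbs with probability \<open>(a + 1) / (a + 2)\<close> and otherwise goes to a
  uniformly chosen level of \<open>{0..a}\<close>; at the top it is uniform on all levels. The entry at
  \<open>b = Suc a\<close> with \<open>a = n\<close> lies outside \<open>{0..n}\<close>, as it does in the antidual matrix.
\<close>

definition climb_or_reset :: "nat \<Rightarrow> nat \<Rightarrow> nat \<Rightarrow> real" where
  "climb_or_reset n a b =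
     (if b = Suc a then (real a + 1) / (real a + 2)
      else if b \<le> a then (if a < n then 1 / ((real a + 1) * (real a + 2)) else 1 / (real n + 1))
      else 0)"

lemma climb_or_reset_pos: "b \<le> Suc a \<Longrightarrow> climb_or_reset n a b > 0"
  by (auto simp: climb_or_reset_def)

lemma climb_or_reset_stochastic: "stochastic_matrix {0..n} {0..n} (climb_or_reset n)"
proof -
  have "(\<Sum>b\<in>{0..n}. climb_or_reset n a b) = 1" if a: "a \<le> n" for a
  proof (cases "a = n")
    case True
    then show ?thesis
      by (simp add: climb_or_reset_def)
  next
    case False
    with a have "{0..n} = {0..a} \<union> {Suc a} \<union> {Suc (Suc a)..n}"
      by auto
    then have "(\<Sum>b\<in>{0..n}. climb_or_reset n a b)
        = (\<Sum>b\<in>{0..a}. climb_or_reset n a b) + climb_or_reset n a (Suc a)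
          + (\<Sum>b\<in>{Suc (Suc a)..n}. climb_or_reset n a b)"
      by (simp only:) (subst sum.union_disjoint; auto simp: sum.union_disjoint)+
    also have "\<dots> = (real a + 1) * (1 / ((real a + 1) * (real a + 2))) + (real a + 1) / (real a + 2)"
      using False a by (simp add: climb_or_reset_def add.commute del: mult_divide_mult_cancel_left_if)
    also have "\<dots> = 1"
      by (simp add: add_divide_distrib[symmetric])
    finally show ?thesis .
  qed
  then show ?thesis
    by (auto simp: stochastic_matrix_def distribution_on_def climb_or_reset_def)
qed

text \<open>
  These are the masses of the image of counting measure on \<open>{0..a}\<close>: its total mass \<open>a + 1\<close> is spread
  evenly over the \<open>a + 2\<close> levels up to \<open>Suc a\<close>. When \<open>a\<close> grows by one, each of the old
  levels gains \<open>1 / ((a + 2) (a + 3))\<close>, which is exactly \<open>(a + 2) / (a + 3) - (a + 1) / (a + 2)\<close>.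
\<close>

lemma climb_or_reset_partial_column_sum:
  "a < n \<Longrightarrow> (\<Sum>x\<in>{0..a}. climb_or_reset n x b) = of_bool (b \<le> Suc a) * ((real a + 1) / (real a + 2))"
proof (induction a)
  case 0
  then show ?case
    by (auto simp: climb_or_reset_def)
next
  case (Suc a)
  have "(real a + 1) / (real a + 2) + 1 / ((real a + 2) * (real a + 3)) = (real a + 2) / (real a + 3)"
    by (simp add: divide_simps) (simp add: algebra_simps)
  with Suc show ?case
    by (auto simp: climb_or_reset_def le_Suc_eq add.commute add.left_commute)
qed

text \<open>
  Both sides are the uniform distribution on the levels up to \<open>min (Suc a) n\<close>. At the top, the
  column sum over all levels is the one below the top, \<open>n / (n + 1)\<close>, plus \<open>1 / (n + 1)\<close>
  from the uniform last row.
\<close>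

lemma uniform_below_intertwining:
  assumes n: "n \<ge> 1" and a: "a \<le> n" and b: "b \<le> n"
  shows "mat_mat {0..n} uniform_below (climb_or_reset n) a b = mat_mat {0..n} (climb n) uniform_below a b"
proof -
  have "mat_mat {0..n} uniform_below (climb_or_reset n) a b
      = (\<Sum>x\<in>{0..n}. if x \<le> a then climb_or_reset n x b / (real a + 1) else 0)"
    by (auto simp: mat_mat_def uniform_below_def intro!: sum.cong)
  also have "\<dots> = (\<Sum>x\<in>{0..a}. climb_or_reset n x b / (real a + 1))"
    using a by (intro sum.mono_neutral_cong_right) auto
  also have "\<dots> = (\<Sum>x\<in>{0..a}. climb_or_reset n x b) / (real a + 1)"
    by (simp add: sum_divide_distrib)
  also have "\<dots> = uniform_below (min (Suc a) n) b"
  proof (cases "a < n")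
    case True
    then show ?thesis
      by (simp add: climb_or_reset_partial_column_sum uniform_below_def min_def add.commute)
  next
    case False
    then obtain m where m: "a = Suc m" "n = Suc m"
      using a n by (cases a) auto
    have "(real m + 1) / (real m + 2) + 1 / (real m + 2) = 1"
      by (simp add: add_divide_distrib[symmetric])
    moreover have "climb_or_reset n a b = 1 / (real m + 2)"
      using m b by (simp add: climb_or_reset_def add.commute)
    ultimately have "(\<Sum>x\<in>{0..a}. climb_or_reset n x b) = 1"
      using climb_or_reset_partial_column_sum[of m n b] m b by simp
    then show ?thesis
      using m b by (simp add: uniform_below_def)
  qed
  also have "\<dots> = mat_mat {0..n} (climb n) uniform_below a b"
    by (simp add: mat_mat_def climb_def of_bool_def if_distrib[of "\<lambda>t. t * _"] cong: if_cong)
  finally show ?thesis .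
qed

lemma uniform_below_distribution: "a \<le> n \<Longrightarrow> distribution_on {0..n} (uniform_below a)"
proof -
  assume a: "a \<le> n"
  have "(\<Sum>b\<in>{0..n}. uniform_below a b) = (\<Sum>b\<in>{0..a}. 1 / (real a + 1))"
    using a by (intro sum.mono_neutral_cong_right) (auto simp: uniform_below_def)
  then show ?thesis
    by (simp add: distribution_on_def uniform_below_def)
qed

section \<open>The coupon collector chain and its antidual as mixtures\<close>

text \<open>
  The selections \<open>k\<close> with \<open>x k = N k\<close> are lost, because \<open>climb\<close> then stays where it is. This is the
  second sum on the diagonal.
\<close>

lemma coupon_matrix_eq_mixture:
  assumes x: "x \<in> coupon_space d N" and y: "y \<in> coupon_space d N"
  shows "coupon_matrix d N p x y = axis_mixture d p (\<lambda>k. climb (N k)) x y"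
proof (cases "y = x")
  case True
  have "(\<Sum>k\<in>{k \<in> {1..d}. x k = N k}. p k) = (\<Sum>k\<in>{1..d}. if x k = N k then p k else 0)"
    by (rule sum.inter_filter) simp
  also have "\<dots> = (\<Sum>k\<in>{1..d}. p k * climb (N k) (x k) (x k))"
    using coupon_space_le[OF x] by (intro sum.cong) (fastforce simp: climb_def min_def)+
  finally show ?thesis
    using True by (simp add: coupon_matrix_def axis_mixture_def)
next
  case False
  have "(if x k < N k \<and> y = x(k := x k + 1) then p k else 0)
      = p k * (of_bool (x(k := y k) = y) * climb (N k) (x k) (y k))" if k: "k \<in> {1..d}" for k
  proof (cases "x(k := y k) = y")
    case True
    then have "y k \<noteq> x k"
      using False by (metis fun_upd_triv)
    moreover have "(y = x(k := x k + 1)) = (y k = Suc (x k))"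
      using True by (metis Suc_eq_plus1 fun_upd_same)
    ultimately show ?thesis
      using True coupon_space_le[OF x k] by (auto simp: climb_def min_def)
  next
    case False
    then have "y \<noteq> x(k := c)" for c
      by auto
    then show ?thesis
      using False by simp
  qed
  then show ?thesis
    using False by (auto simp: coupon_matrix_def axis_mixture_def intro!: sum.cong)
qed

text \<open>
  On the diagonal, the subtracted coefficient of \<open>p j\<close> is the probability that \<open>climb_or_reset\<close>
  leaves \<open>x j\<close>.
\<close>

lemma antidual_matrix_eq_mixture:
  assumes x: "x \<in> coupon_space d N" and y: "y \<in> coupon_space d N"
  shows "antidual_matrix d N p x y = axis_mixture d p (\<lambda>k. climb_or_reset (N k)) x y"
proof (cases "y = x")
  case True
  have "(\<Sum>j\<in>{j\<in>{1..d}. x j < N j}. (1 - 1 / ((real (x j) + 1) * (real (x j) + 2))) * p j)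
        + (\<Sum>j\<in>{j\<in>{1..d}. x j = N j}. real (N j) / (real (N j) + 1) * p j)
      = (\<Sum>j\<in>{1..d}. (if x j < N j then (1 - 1 / ((real (x j) + 1) * (real (x j) + 2))) * p j else 0)
        + (if x j = N j then real (N j) / (real (N j) + 1) * p j else 0))"
    unfolding sum.distrib by (intro arg_cong2[where f = plus] sum.inter_filter) simp_all
  also have "\<dots> = (\<Sum>j\<in>{1..d}. p j - p j * climb_or_reset (N j) (x j) (x j))"
  proof (rule sum.cong)
    fix j assume "j \<in> {1..d}"
    then have "x j \<le> N j"
      by (rule coupon_space_le[OF x])
    moreover have "real (N j) / (real (N j) + 1) = 1 - 1 / (real (N j) + 1)"
      by (simp add: field_simps)
    ultimately show "(if x j < N j then (1 - 1 / ((real (x j) + 1) * (real (x j) + 2))) * p j else 0)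
        + (if x j = N j then real (N j) / (real (N j) + 1) * p j else 0)
        = p j - p j * climb_or_reset (N j) (x j) (x j)"
      by (auto simp: climb_or_reset_def left_diff_distrib)
  qed simp
  finally show ?thesis
    using True by (simp add: antidual_matrix_def axis_mixture_def sum_subtractf)
next
  case False
  have "(if y = x(k := x k + 1) then (real (x k) + 1) / (real (x k) + 2) * p k
       else if \<exists>m\<in>{1..x k}. y = x(k := x k - m) then
         (of_bool (x k < N k) / ((real (x k) + 1) * (real (x k) + 2))
           + of_bool (x k = N k) / (real (N k) + 1)) * p k
       else 0) = p k * (of_bool (x(k := y k) = y) * climb_or_reset (N k) (x k) (y k))"
    if k: "k \<in> {1..d}" for k
  proof (cases "x(k := y k) = y")
    case True
    then have "y k \<noteq> x k"
      using False by (metis fun_upd_triv)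
    moreover have at: "(y = x(k := c)) = (y k = c)" for c
      using True by (metis fun_upd_same)
    have "(\<exists>m\<in>{1..x k}. y k = x k - m) = (y k < x k)"
    proof
      assume "y k < x k"
      then show "\<exists>m\<in>{1..x k}. y k = x k - m"
        by (intro bexI[of _ "x k - y k"]) auto
    qed auto
    ultimately show ?thesis
      unfolding at using True coupon_space_le[OF x k] by (auto simp: climb_or_reset_def)
  next
    case False
    then have "y \<noteq> x(k := c)" for c
      by auto
    then show ?thesis
      using False by simp
  qed
  then show ?thesis
    using False by (auto simp: antidual_matrix_def axis_mixture_def intro!: sum.cong)
qed

lemma coupon_matrix_stochastic:
  assumes "\<And>k. k \<in> {1..d} \<Longrightarrow> p k \<ge> 0" "(\<Sum>k\<in>{1..d}. p k) \<le> 1"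
  shows "stochastic_matrix (coupon_space d N) (coupon_space d N) (coupon_matrix d N p)"
proof -
  have "stochastic_matrix {0..n} {0..n} (climb n)" for n
    by (auto simp: stochastic_matrix_def distribution_on_def climb_def of_bool_def)
  from axis_mixture_stochastic[OF assms this] show ?thesis
    by (simp add: stochastic_matrix_def distribution_on_def coupon_matrix_eq_mixture)
qed

lemma antidual_matrix_stochastic:
  assumes "\<And>k. k \<in> {1..d} \<Longrightarrow> p k \<ge> 0" "(\<Sum>k\<in>{1..d}. p k) \<le> 1"
  shows "stochastic_matrix (coupon_space d N) (coupon_space d N) (antidual_matrix d N p)"
  using axis_mixture_stochastic[OF assms climb_or_reset_stochastic]
  by (simp add: stochastic_matrix_def distribution_on_def antidual_matrix_eq_mixture)

lemma antidual_link_intertwining: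
  assumes N: "\<And>j. j \<in> {1..d} \<Longrightarrow> N j \<ge> 1"
    and x: "x \<in> coupon_space d N" and y: "y \<in> coupon_space d N"
  shows "mat_mat (coupon_space d N) (product_kernel d uniform_below) (antidual_matrix d N p) x y
    = mat_mat (coupon_space d N) (coupon_matrix d N p) (product_kernel d uniform_below) x y"
  using axis_mixture_intertwining[OF uniform_below_intertwining[OF N] x y, of p] x y
  by (simp add: mat_mat_def antidual_matrix_eq_mixture coupon_matrix_eq_mixture)

lemma coupon_zero_in: "coupon_zero d \<in> coupon_space d N"
  by (auto simp: coupon_zero_def coupon_space_def)

lemma coupon_max_in: "coupon_max d N \<in> coupon_space d N"
  by (auto simp: coupon_max_def coupon_space_def)

lemma coupon_max_absorbing:
  assumes "y \<in> coupon_space d N" "y \<noteq> coupon_max d N"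
  shows "coupon_matrix d N p (coupon_max d N) y = 0"
  using assms by (auto simp: coupon_matrix_def coupon_max_def intro!: sum.neutral)

lemma link_at_max:
  assumes y: "y \<in> coupon_space d N"
  shows "product_kernel d uniform_below (coupon_max d N) y = 1 / real (card (coupon_space d N))"
proof -
  have "card (coupon_space d N) = (\<Prod>j\<in>{1..d}. N j + 1)"
    by (simp add: coupon_space_def card_PiE)
  then have "1 / real (card (coupon_space d N)) = (\<Prod>j\<in>{1..d}. 1 / (real (N j) + 1))"
    by (simp add: prod_dividef add.commute)
  then show ?thesis
    using coupon_space_le[OF y] by (simp add: product_kernel_def uniform_below_def coupon_max_def)
qed

lemma link_at_zero:
  assumes y: "y \<in> coupon_space d N"
  shows "product_kernel d uniform_below (coupon_zero d) y = point_mass (coupon_zero d) y"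
proof (cases "y = coupon_zero d")
  case True
  then show ?thesis
    by (simp add: product_kernel_def uniform_below_def coupon_zero_def point_mass_def)
next
  case False
  then obtain j where "j \<in> {1..d}" "y j \<noteq> coupon_zero d j"
    using coupon_space_eqI[OF y coupon_zero_in] by blast
  then show ?thesis
    using False by (auto simp: product_kernel_def uniform_below_def coupon_zero_def point_mass_def
        intro!: prod_zero bexI[of _ j])
qed

text \<open>
  The box below any other state misses the maximal one. This makes the duality sharp.
\<close>

lemma link_to_max:
  assumes x: "x \<in> coupon_space d N" "x \<noteq> coupon_max d N"
  shows "product_kernel d uniform_below x (coupon_max d N) = 0"
proof -
  obtain j where "j \<in> {1..d}" "x j \<noteq> coupon_max d N j"
    using coupon_space_eqI[OF x(1) coupon_max_in] x(2) by blast
  then show ?thesis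
    using coupon_space_le[OF x(1), of j]
    by (auto simp: product_kernel_def uniform_below_def coupon_max_def intro!: prod_zero bexI[of _ j])
qed

lemma antidual_matrix_axis_pos:
  assumes p: "\<And>j. j \<in> {1..d} \<Longrightarrow> p j > 0" "(\<Sum>j\<in>{1..d}. p j) \<le> 1"
    and x: "x \<in> coupon_space d N" and k: "k \<in> {1..d}" and c: "c \<le> N k" "c \<le> Suc (x k)"
  shows "antidual_matrix d N p x (x(k := c)) > 0"
proof -
  let ?y = "x(k := c)"
  have y: "?y \<in> coupon_space d N"
    using coupon_space_update[OF x k c(1)] .
  have "(\<Sum>j\<in>{1..d}. p j * (of_bool (x(j := ?y j) = ?y) * climb_or_reset (N j) (x j) (?y j))) > 0"
  proof (rule sum_pos2[OF _ k])
    show "0 < p k * (of_bool (x(k := ?y k) = ?y) * climb_or_reset (N k) (x k) (?y k))"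
      using p(1)[OF k] climb_or_reset_pos[OF c(2)] by simp
    show "0 \<le> p j * (of_bool (x(j := ?y j) = ?y) * climb_or_reset (N j) (x j) (?y j))"
      if "j \<in> {1..d}" for j
      using p(1)[OF that] by (auto simp: climb_or_reset_def)
  qed simp
  then show ?thesis
    unfolding antidual_matrix_eq_mixture[OF x y] axis_mixture_def
    using p(2) by (intro add_nonneg_pos) auto
qed

text \<open>
  Lowering a positive coordinate by one and raising it again are both possible, so induction on the
  sum of the coordinates connects every state with zero in both directions. Selecting a coordinate
  and leaving it unchanged gives loops, which exclude periods greater than one.
\<close>

lemma antidual_matrix_ergodic:
  assumes d: "d \<ge> 1" and p: "\<And>j. j \<in> {1..d} \<Longrightarrow> p j > 0" "(\<Sum>j\<in>{1..d}. p j) \<le> 1"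
  shows "ergodic_chain (coupon_space d N) (antidual_matrix d N p)"
proof -
  let ?E = "coupon_space d N" and ?P = "antidual_matrix d N p" and ?z = "coupon_zero d"
  let ?R = "{(u, v). u \<in> ?E \<and> v \<in> ?E \<and> ?P u v > 0}"
  have nonneg: "?P x y \<ge> 0" if "x \<in> ?E" "y \<in> ?E" for x y
    using antidual_matrix_stochastic[of d p N] p that
    by (auto simp: stochastic_matrix_def distribution_on_def less_imp_le)
  have to_from_zero: "(x, ?z) \<in> ?R\<^sup>* \<and> (?z, x) \<in> ?R\<^sup>*" if "x \<in> ?E" for x
    using that
  proof (induction "\<Sum>j\<in>{1..d}. x j" arbitrary: x rule: less_induct)
    case less
    show ?case
    proof (cases "x = ?z")
      case False
      then obtain k where k: "k \<in> {1..d}" "x k \<noteq> ?z k"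
        using coupon_space_eqI[OF less.prems coupon_zero_in] by blast
      then obtain a where a: "x k = Suc a"
        by (cases "x k") (auto simp: coupon_zero_def)
      have aN: "Suc a \<le> N k"
        using coupon_space_le[OF less.prems k(1)] a by simp
      let ?y = "x(k := a)"
      have y: "?y \<in> ?E"
        using coupon_space_update[OF less.prems k(1)] aN by simp
      have xy: "?y(k := Suc a) = x"
        using a by auto
      have "(\<Sum>j\<in>{1..d}. ?y j) < (\<Sum>j\<in>{1..d}. x j)"
        using k(1) a by (intro sum_strict_mono_ex1) auto
      then have "(?y, ?z) \<in> ?R\<^sup>* \<and> (?z, ?y) \<in> ?R\<^sup>*"
        using less.hyps y by blast
      moreover have "(x, ?y) \<in> ?R"
        using antidual_matrix_axis_pos[OF p less.prems k(1), of a] a aN less.prems y by simp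
      moreover have "(?y, x) \<in> ?R"
        using antidual_matrix_axis_pos[OF p y k(1), of "Suc a"] aN less.prems y xy by simp
      ultimately show ?thesis
        by (meson converse_rtrancl_into_rtrancl rtrancl.rtrancl_into_rtrancl)
    qed simp
  qed
  have "irreducible_chain ?E ?P"
    unfolding irreducible_chain_def
  proof (intro ballI)
    fix x y assume xy: "x \<in> ?E" "y \<in> ?E"
    then have "(x, y) \<in> ?R\<^sup>*"
      using to_from_zero by (meson rtrancl_trans)
    then show "\<exists>n. mat_pow ?E ?P n x y > 0"
      by (intro mat_pow_pos_of_steps nonneg xy(1)) auto
  qed
  moreover have "aperiodic_chain ?E ?P"
    unfolding aperiodic_chain_def
  proof
    fix x assume x: "x \<in> ?E"
    have one: "1 \<in> {1..d}"
      using d by simp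
    have "?P x x > 0"
      using antidual_matrix_axis_pos[OF p x one, of "x 1"] coupon_space_le[OF x one] by simp
    moreover have "mat_pow ?E ?P 1 x x = ?P x x"
      using x by (simp add: mat_mat_def if_distrib[of "\<lambda>t. t * _"] cong: if_cong)
    ultimately have "1 \<in> {n. 0 < n \<and> mat_pow ?E ?P n x x > 0}"
      by simp
    then show "Gcd {n. 0 < n \<and> mat_pow ?E ?P n x x > 0} = 1"
      by (metis Gcd_dvd nat_dvd_1_iff_1)
  qed
  ultimately show ?thesis
    by (simp add: ergodic_chain_def)
qed


theorem theorem4p4:
  fixes d :: nat and N :: "nat \<Rightarrow> nat" and p :: "nat \<Rightarrow> real"
    and M :: "'w measure" and X' :: "nat \<Rightarrow> 'w \<Rightarrow> (nat \<Rightarrow> nat)"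
  assumes "d \<ge> 1"
    and "\<And>j. j \<in> {1..d} \<Longrightarrow> N j \<ge> 1"
    and "\<And>j. j \<in> {1..d} \<Longrightarrow> p j > 0"
    and "(\<Sum>j\<in>{1..d}. p j) \<le> 1"
    and "markov_chain M X' (coupon_space d N) (point_mass (coupon_zero d)) (coupon_matrix d N p)"
    and "(\<Sum>j\<in>{1..d}. (1 - 1 / (real (N j) * (real (N j) + 1))) * p j) \<le> 1"
  shows "stochastic_matrix (coupon_space d N) (coupon_space d N) (antidual_matrix d N p)
    \<and> ergodic_chain (coupon_space d N) (antidual_matrix d N p)
    \<and> stationary_distribution (coupon_space d N) (antidual_matrix d N p)
        (\<lambda>_. 1 / real (card (coupon_space d N)))
    \<and> sharp_antidual
        (coupon_space d N) (point_mass (coupon_zero d)) (antidual_matrix d N p)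
        (\<lambda>_. 1 / real (card (coupon_space d N)))
        M X' (coupon_space d N) (point_mass (coupon_zero d)) (coupon_matrix d N p)
        (coupon_max d N)"
proof -
  let ?E = "coupon_space d N" and ?P = "antidual_matrix d N p" and ?C = "coupon_matrix d N p"
  let ?\<nu> = "point_mass (coupon_zero d)" and ?a = "coupon_max d N"
  let ?\<pi> = "\<lambda>_::nat \<Rightarrow> nat. 1 / real (card ?E)" and ?\<Lambda> = "product_kernel d uniform_below"
  note N = assms(2) and p = assms(3) and p_sum = assms(4) and mc = assms(5)
  have p_nonneg: "\<And>j. j \<in> {1..d} \<Longrightarrow> p j \<ge> 0"
    using p by (simp add: less_imp_le)
  note stoch_P = antidual_matrix_stochastic[OF p_nonneg p_sum]
    and stoch_C = coupon_matrix_stochastic[OF p_nonneg p_sum]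
    and ergodic = antidual_matrix_ergodic[OF assms(1) p p_sum]
  have stoch_\<Lambda>: "stochastic_matrix ?E ?E ?\<Lambda>"
    by (intro product_kernel_stochastic uniform_below_distribution)
  have link: "mat_mat ?E ?\<Lambda> ?P x y = mat_mat ?E ?C ?\<Lambda> x y" if "x \<in> ?E" "y \<in> ?E" for x y
    using antidual_link_intertwining[OF N that] .
  have card_pos: "card ?E > 0"
    using coupon_zero_in by (auto simp: card_gt_0_iff)
  have start: "?\<nu> y = vec_mat ?E ?\<nu> ?\<Lambda> y" if y: "y \<in> ?E" for y
    using link_at_zero[OF y] coupon_zero_in[of d N]
    by (simp add: vec_mat_def point_mass_def indicator_def if_distrib[of "\<lambda>t. t * _"] cong: if_cong)
  have dist_\<nu>: "distribution_on ?E ?\<nu>"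
    using coupon_zero_in[of d N] by (simp add: distribution_on_def point_mass_def indicator_def)
  have stationary: "stationary_distribution ?E ?P ?\<pi>"
  proof -
    have "vec_mat ?E ?\<pi> ?P y = ?\<pi> y" if y: "y \<in> ?E" for y
    proof -
      \<comment> \<open>The link's row at the absorbing state is \<open>\<pi>\<close>, and absorption fixes this row.\<close>
      have "vec_mat ?E ?\<pi> ?P y = mat_mat ?E ?\<Lambda> ?P ?a y"
        by (simp add: vec_mat_def mat_mat_def link_at_max)
      also have "\<dots> = (\<Sum>z\<in>?E. ?C ?a z * ?\<Lambda> z y)"
        using link[OF coupon_max_in y] by (simp add: mat_mat_def)
      also have "\<dots> = ?C ?a ?a * ?\<Lambda> ?a y"
        using coupon_max_absorbing by (subst sum.remove[OF _ coupon_max_in]) auto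
      also have "?C ?a ?a = (\<Sum>z\<in>?E. ?C ?a z)"
        using coupon_max_absorbing by (subst sum.remove[OF _ coupon_max_in]) auto
      also have "\<dots> = 1"
        using stoch_C coupon_max_in by (auto simp: stochastic_matrix_def distribution_on_def)
      finally show ?thesis
        using link_at_max[OF y] by simp
    qed
    then show ?thesis
      using card_pos coupon_zero_in by (auto simp: stationary_distribution_def distribution_on_def)
  qed
  have sharp: "separation ?E (vec_mat ?E ?\<nu> (mat_pow ?E ?P k)) ?\<pi>
      = measure M {\<omega> \<in> space M. absorption_time X' ?a \<omega> > enat k}" for k
  proof -
    have "separation ?E (vec_mat ?E ?\<nu> (mat_pow ?E ?P k)) ?\<pi>
        = separation ?E (vec_mat ?E (vec_mat ?E ?\<nu> (mat_pow ?E ?C k)) ?\<Lambda>) ?\<pi>"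
      unfolding separation_def
      by (intro arg_cong[where f = Max] image_cong refl)
        (simp add: link_transports_law[OF _ _ start link])
    also have "\<dots> = 1 - vec_mat ?E ?\<nu> (mat_pow ?E ?C k) ?a"
      using card_pos coupon_max_in distribution_vec_mat_pow[OF _ dist_\<nu> stoch_C]
      by (intro separation_of_sharp_link[where b = ?a] stoch_\<Lambda> link_at_max link_to_max) auto
    also have "\<dots> = measure M {\<omega> \<in> space M. absorption_time X' ?a \<omega> > enat k}"
      by (rule absorption_time_tail[symmetric]) (simp_all add: mc coupon_max_in coupon_max_absorbing)
    finally show ?thesis .
  qed
  show ?thesis
    unfolding sharp_antidual_def
    using stoch_P stoch_\<Lambda> ergodic stationary dist_\<nu> mc sharp start link link_at_max by blast
qed

end
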